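(* Box-convexity is not preserved by adding non-maximal codewords: the codes $\mathcal{C} = \{1234, 12, 13, \emptyset\}$ and $\mathcal{D} = \{1234, 12, 13, 14, \emptyset\}$ on $\{1,2,3,4\}$ satisfy $\mathcal{C}\subseteq\mathcal{D}\subseteq\Delta(\mathcal{C})$, the code $\mathcal{C}$ is box-convex (in fact it is realizable by closed intervals in $\mathbb{R}^1$), but $\mathcal{D}$ is not box-convex.
   Context: Write $[n]=\{1,\ldots,n\}$. A code is a set $\mathcal{C}\subseteq 2^{[n]}$; subsets of $[n]$ are abbreviated by listing their elements, e.g. $12=\{1,2\}$. For an ordered (indexed) collection $\mathcal{U} = \{U_1, \ldots, U_n\}$ of sets in $\mathbb{R}^d$, its code is $$\operatorname{code}(\mathcal{U}) = \{\sigma\subseteq [n] \mid \text{there exists } p\in \mathbb{R}^d \text{ such that for all } i\in[n],\ p\in U_i \text{ if and only if } i\in\sigma\},$$ and $\mathcal{U}$ is called a realization of $\operatorname{code}(\mathcal{U})$. An axis-parallel box (box for short) in $\mathbb{R}^d$ is either the empty set or a product $[a_1,b_1]\times\cdots\times[a_d,b_d]$ of nonempty closed intervals (degenerate intervals $a_i=b_i$ allowed). A code is box-convex if, for some $d$, it has a realization in $\mathbb{R}^d$ in which every set is a box. For a code $\mathcal{C}\subseteq 2^{[n]}$, $\Delta(\mathcal{C}) = \{\sigma\subseteq [n]\mid \sigma\subseteq c\text{ for some }c\in \mathcal{C}\}$ is the abstract simplicial complex generated by $\mathcal{C}$. *)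

theory Defs
  imports "HOL-Analysis.Analysis"
begin

text \<open>
  The dimension \<open>d\<close> is quantified inside the notion of box-convexity, so it cannot be a type:
  points of \<open>d\<close>-dimensional space are the real functions on \<open>{1..d}\<close>, made unique by being
  \<^const>\<open>undefined\<close> elsewhere.
\<close>

definition real_space :: "nat \<Rightarrow> (nat \<Rightarrow> real) set" where
  "real_space d = {1..d} \<rightarrow>\<^sub>E UNIV"

text \<open>Only the sets \<open>U 1, \<dots>, U n\<close> of the family \<open>U\<close> matter.\<close>

definition code_of :: "nat \<Rightarrow> nat \<Rightarrow> (nat \<Rightarrow> (nat \<Rightarrow> real) set) \<Rightarrow> nat set set" where
  "code_of d n U =
     {\<sigma>. \<sigma> \<subseteq> {1..n} \<and> (\<exists>p \<in> real_space d. \<forall>i \<in> {1..n}. p \<in> U i \<longleftrightarrow> i \<in> \<sigma>)}"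

definition is_box :: "nat \<Rightarrow> (nat \<Rightarrow> real) set \<Rightarrow> bool" where
  "is_box d B \<longleftrightarrow>
     B = {} \<or> (\<exists>a b. (\<forall>j \<in> {1..d}. a j \<le> b j) \<and> B = (\<Pi>\<^sub>E j \<in> {1..d}. {a j..b j}))"

definition box_convex :: "nat \<Rightarrow> nat set set \<Rightarrow> bool" where
  "box_convex n C \<longleftrightarrow> (\<exists>d U. (\<forall>i \<in> {1..n}. is_box d (U i)) \<and> code_of d n U = C)"

definition simplicial_complex_of :: "nat \<Rightarrow> nat set set \<Rightarrow> nat set set" where
  "simplicial_complex_of n C = {\<sigma>. \<sigma> \<subseteq> {1..n} \<and> (\<exists>c \<in> C. \<sigma> \<subseteq> c)}"

end

(*
  In a realization of D by boxes, the box U 1 is the union of the boxes U 2, U 3, U 4, any two of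
  which meet exactly in K = U 2 \<inter> U 3 \<inter> U 4, a nonempty box. By connectedness, every segment in U 1
  joining points of two different U i meets K. Choose x i in U i - K for i = 2, 3, 4 and a coordinate
  j in which x 2 leaves K. Walking from x 2 to x 3 so that the coordinate j is changed last, one can
  meet K only in the last leg, so x 3 leaves K only in the coordinate j, on the side opposite to x 2.
  The same holds for each pair of the three points, but a line has only two sides.
*)
theory Submission
  imports Defs
begin

section \<open>Coordinatewise segments, codes and boxes\<close>

text \<open>Restriction to \<open>{1..d}\<close> keeps the point extensional, so that it can lie in
  a box, and makes the endpoints come back as equal functions.\<close>

definition seg :: "nat \<Rightarrow> (nat \<Rightarrow> real) \<Rightarrow> (nat \<Rightarrow> real) \<Rightarrow> real \<Rightarrow> nat \<Rightarrow> real" where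
  "seg d p q t = (\<lambda>i\<in>{1..d}. (1 - t) * p i + t * q i)"

text \<open>Every point determines exactly one codeword, so a code is the image of the map sending a
  point to its codeword. Both code computations below run through this map.\<close>

lemma code_of_eq_image: "code_of d n U = (\<lambda>p. {i \<in> {1..n}. p \<in> U i}) ` real_space d"
proof -
  have *: "\<sigma> \<subseteq> {1..n} \<and> (\<forall>i\<in>{1..n}. p \<in> U i \<longleftrightarrow> i \<in> \<sigma>) \<longleftrightarrow> \<sigma> = {i \<in> {1..n}. p \<in> U i}" for \<sigma> p
    by blast
  show ?thesis
    unfolding set_eq_iff code_of_def image_iff mem_Collect_eq *[symmetric] by blast
qed

lemma is_box_subset_real_space: "is_box d B \<Longrightarrow> B \<subseteq> real_space d"
  by (auto simp: is_box_def real_space_def PiE_iff)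

lemma is_box_Int:
  assumes "is_box d A" "is_box d B"
  shows "is_box d (A \<inter> B)"
proof (cases "A \<inter> B = {}")
  case True
  then show ?thesis by (simp add: is_box_def)
next
  case False
  then obtain x where x: "x \<in> A" "x \<in> B" by blast
  with assms obtain a b a' b' where
    AB: "A = (\<Pi>\<^sub>E j \<in> {1..d}. {a j..b j})" "B = (\<Pi>\<^sub>E j \<in> {1..d}. {a' j..b' j})"
    unfolding is_box_def by blast
  have "A \<inter> B = (\<Pi>\<^sub>E j \<in> {1..d}. {max (a j) (a' j)..min (b j) (b' j)})"
    unfolding AB by (auto simp: PiE_iff)
  moreover have "\<forall>j\<in>{1..d}. max (a j) (a' j) \<le> min (b j) (b' j)"
    using x unfolding AB PiE_iff by fastforce
  ultimately show ?thesis
    unfolding is_box_def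
    by (intro disjI2 exI[of _ "\<lambda>j. max (a j) (a' j)"] exI[of _ "\<lambda>j. min (b j) (b' j)"]) simp
qed

lemma seg_in_box:
  assumes "is_box d B" "p \<in> B" "q \<in> B" "0 \<le> t" "t \<le> 1"
  shows "seg d p q t \<in> B"
proof -
  obtain a b where B: "B = (\<Pi>\<^sub>E j \<in> {1..d}. {a j..b j})"
    using assms(1,2) by (auto simp: is_box_def)
  have "(1 - t) * p j + t * q j \<in> {a j..b j}" if "j \<in> {1..d}" for j
    using convexD[OF convex_real_interval(5)[of "a j" "b j"], of "p j" "q j" "1 - t" t] that assms
    by (auto simp: B PiE_iff)
  then show ?thesis by (simp add: B seg_def)
qed

lemma closed_seg_vimage:
  assumes "is_box d B"
  shows "closed {t. seg d p q t \<in> B}"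
proof (cases "B = {}")
  case False
  then obtain a b where B: "B = (\<Pi>\<^sub>E j \<in> {1..d}. {a j..b j})"
    using assms by (auto simp: is_box_def)
  have "{t. seg d p q t \<in> B} =
      (\<Inter>j\<in>{1..d}. {t. a j \<le> (1 - t) * p j + t * q j} \<inter> {t. (1 - t) * p j + t * q j \<le> b j})"
    by (auto simp: B seg_def)
  then show ?thesis
    by (simp only:) (intro closed_INT ballI closed_Int closed_Collect_le continuous_intros)
qed simp

section \<open>Sunflowers of boxes whose union is a box\<close>

text \<open>The boxes form a sunflower with core \<open>K\<close>. In the application the petals are
  \<open>U 2\<close>, \<open>U 3\<close>, \<open>U 4\<close> and their union is
  \<open>U 1\<close>.\<close>

locale box_star =
  fixes d :: nat and I :: "'i set" and A :: "'i \<Rightarrow> (nat \<Rightarrow> real) set" and K :: "(nat \<Rightarrow> real) set"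
  assumes finite_I: "finite I"
    and box_A: "\<And>i. i \<in> I \<Longrightarrow> is_box d (A i)"
    and box_Union: "is_box d (\<Union>i\<in>I. A i)"
    and Int_A: "\<And>i k. \<lbrakk>i \<in> I; k \<in> I; i \<noteq> k\<rbrakk> \<Longrightarrow> A i \<inter> A k = K"
begin

text \<open>The union is a box, so it contains the segment. If the segment missed \<open>K\<close>,
  the parameters in \<open>A i\<close> and those in the other boxes would split
  \<open>{0..1}\<close> into two disjoint nonempty closed parts.\<close>

lemma seg_meets_core:
  assumes "i \<in> I" "k \<in> I" "i \<noteq> k" "p \<in> A i" "q \<in> A k"
  shows "\<exists>t. 0 \<le> t \<and> t \<le> 1 \<and> seg d p q t \<in> K"
proof (rule ccontr)
  assume no: "\<not> ?thesis"
  \<comment> \<open>\<open>?T\<close> pools all boxes other than \<open>A i\<close>; it is closed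
    because \<open>I\<close> is finite.\<close>
  let ?S = "{t. seg d p q t \<in> A i}" and ?T = "\<Union>m\<in>I - {i}. {t. seg d p q t \<in> A m}"
  have closed: "closed ?S" "closed ?T"
    using assms(1) finite_I box_A by (auto intro: closed_seg_vimage)
  have cover: "{0..1} \<subseteq> ?S \<union> ?T"
    using seg_in_box[OF box_Union, of p q] assms by fastforce
  have disjoint: "?S \<inter> ?T \<inter> {0..1} = {}"
    using no Int_A assms(1) by fastforce
  have "0 \<in> ?S" "1 \<in> ?T"
  proof -
    have "p \<in> extensional {1..d}" "q \<in> extensional {1..d}"
      using is_box_subset_real_space box_A assms by (fastforce simp: real_space_def PiE_def)+
    then have "seg d p q 0 = p" "seg d p q 1 = q"
      by (simp_all add: seg_def extensional_restrict)
    then show "0 \<in> ?S" "1 \<in> ?T" using assms by auto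
  qed
  then have "?S \<inter> {0..1} \<noteq> {}" "?T \<inter> {0..1} \<noteq> {}"
    by (metis IntI atLeastAtMost_iff empty_iff order_refl zero_le_one)+
  then show False
    using connected_closedD[OF connected_Icc disjoint cover closed] by blast
qed

text \<open>The walk goes from \<open>x\<close> to \<open>z\<close> with coordinate \<open>j\<close>
  frozen, then from \<open>z\<close> to \<open>y\<close> changing only \<open>j\<close>. The first
  leg avoids \<open>K\<close>, so \<open>z\<close> is still in \<open>A i\<close>; hence the second
  leg meets \<open>K\<close>, and its \<open>j\<close>-th coordinate passes through
  \<open>{c j..e j}\<close>.\<close>

lemma opposite_sides:
  assumes K: "K = (\<Pi>\<^sub>E j \<in> {1..d}. {c j..e j})"
    and ik: "i \<in> I" "k \<in> I" "i \<noteq> k"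
    and xy: "x \<in> A i" "y \<in> A k - K"
    and j: "j \<in> {1..d}" "x j \<notin> {c j..e j}"
  shows "x j < c j \<and> e j < y j \<or> e j < x j \<and> y j < c j"
proof -
  define z where "z = y(j := x j)"
  \<comment> \<open>The union is a product, so exchanging one coordinate between two of its points
    stays inside; convexity alone would not give this.\<close>
  have z_in: "z \<in> (\<Union>i\<in>I. A i)"
  proof -
    have x: "x \<in> (\<Union>i\<in>I. A i)" and y: "y \<in> (\<Union>i\<in>I. A i)" using ik xy by auto
    then obtain a b where P: "(\<Union>i\<in>I. A i) = (\<Pi>\<^sub>E j \<in> {1..d}. {a j..b j})"
      using box_Union unfolding is_box_def by blast
    show ?thesis using x y j(1) unfolding P z_def by (auto simp: PiE_iff extensional_def)
  qed
  then obtain m where m: "m \<in> I" "z \<in> A m" by blast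
  \<comment> \<open>If \<open>z\<close> were in another box, the segment from \<open>x\<close> to
    \<open>z\<close> would meet \<open>K\<close>, but its \<open>j\<close>-th coordinate is
    constantly \<open>x j\<close>.\<close>
  have "m = i"
  proof (rule ccontr)
    assume "m \<noteq> i"
    then obtain t where "seg d x z t \<in> K"
      using seg_meets_core[of i m x z] m ik xy by auto
    moreover have "seg d x z t j = x j"
      using j(1) by (simp add: seg_def z_def algebra_simps)
    ultimately show False using j unfolding K by (metis PiE_mem)
  qed
  then obtain t where t: "0 \<le> t" "t \<le> 1" "seg d z y t \<in> K"
    using seg_meets_core[of i k z y] m ik xy by auto
  have "y l \<in> {c l..e l}" if "l \<in> {1..d}" "l \<noteq> j" for l
  proof -
    have "seg d z y t l = y l"
      using that by (simp add: seg_def z_def algebra_simps)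
    then show ?thesis using t(3) that unfolding K by (metis PiE_mem)
  qed
  moreover have "y \<in> extensional {1..d}"
    using is_box_subset_real_space[OF box_A[OF ik(2)]] xy by (auto simp: real_space_def PiE_def)
  \<comment> \<open>All other coordinates of \<open>y\<close> fit \<open>K\<close>, so only
    coordinate \<open>j\<close> can keep \<open>y\<close> outside.\<close>
  ultimately have yj: "y j \<notin> {c j..e j}"
    using xy(2) unfolding K Diff_iff PiE_iff by blast
  have w: "(1 - t) * x j + t * y j \<in> {c j..e j}"
    using PiE_mem[OF t(3)[unfolded K] j(1)] j(1) by (simp add: seg_def z_def)
  \<comment> \<open>A convex combination of \<open>x j\<close> and \<open>y j\<close> lies in
    \<open>{c j..e j}\<close>, so the two values cannot be on the same side of it. Negation turns
    the upper side into the lower one.\<close>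
  have "\<not> (x j < c j \<and> y j < c j)"
    using convex_bound_lt[of "x j" "c j" "y j" "1 - t" t] t w by auto
  moreover have "\<not> (e j < x j \<and> e j < y j)"
    using convex_bound_lt[of "- x j" "- e j" "- y j" "1 - t" t] t w by auto
  ultimately show ?thesis using j yj by auto
qed

lemma no_three_petals:
  assumes "K \<noteq> {}"
    and "i \<in> I" "k \<in> I" "l \<in> I" "i \<noteq> k" "i \<noteq> l" "k \<noteq> l"
  shows "A i \<subseteq> K \<or> A k \<subseteq> K \<or> A l \<subseteq> K"
proof (rule ccontr)
  assume "\<not> ?thesis"
  then obtain x y z where xyz: "x \<in> A i - K" "y \<in> A k - K" "z \<in> A l - K" by blast
  have "is_box d K"
    using is_box_Int[OF box_A box_A, of i k] Int_A[of i k] assms by simp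
  then obtain c e where ce: "\<forall>j\<in>{1..d}. c j \<le> e j"
    and K: "K = (\<Pi>\<^sub>E j \<in> {1..d}. {c j..e j})"
    using assms(1) by (auto simp: is_box_def)
  have "x \<in> extensional {1..d}"
    using is_box_subset_real_space[OF box_A[OF assms(2)]] xyz
    by (auto simp: real_space_def PiE_def)
  then obtain j where j: "j \<in> {1..d}" "x j \<notin> {c j..e j}"
    using xyz(1) unfolding K Diff_iff PiE_iff by blast
  have 1: "x j < c j \<and> e j < y j \<or> e j < x j \<and> y j < c j"
    using opposite_sides[OF K, of i k x y j] xyz assms j by auto
  have 2: "x j < c j \<and> e j < z j \<or> e j < x j \<and> z j < c j"
    using opposite_sides[OF K, of i l x z j] xyz assms j by auto
  \<comment> \<open>By \<open>1\<close>, \<open>y\<close> also leaves \<open>K\<close> in coordinate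
    \<open>j\<close>, so the same \<open>j\<close> serves for the pair \<open>y\<close>,
    \<open>z\<close>. Since \<open>c j \<le> e j\<close>, the two sides exclude each other, and
    three points cannot be pairwise opposite.\<close>
  have "c j \<le> e j" using ce j(1) by blast
  then have 3: "y j < c j \<and> e j < z j \<or> e j < y j \<and> z j < c j"
    using opposite_sides[OF K, of k l y z j] xyz assms j(1) 1 by auto
  show False using 1 2 3 \<open>c j \<le> e j\<close> by linarith
qed

end

section \<open>The code with three petals\<close>

lemma atLeastAtMost_1_4: "{1..4::nat} = {1, 2, 3, 4}"
  by auto

lemma not_box_convex_three_petals:
  "\<not> box_convex 4 {{1, 2, 3, 4}, {1, 2}, {1, 3}, {1, 4}, {}}" (is "\<not> box_convex 4 ?D")
proof
  assume "box_convex 4 ?D"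
  then obtain d U where box: "\<And>i. i \<in> {1..4} \<Longrightarrow> is_box d (U i)" and code: "code_of d 4 U = ?D"
    unfolding box_convex_def by blast
  define w where "w p = {i \<in> {1..4}. p \<in> U i}" for p
  have img: "w ` real_space d = ?D"
    using code unfolding code_of_eq_image w_def .
  have mem: "i \<in> w p \<longleftrightarrow> p \<in> U i" if "i \<in> {1..4}" for i p
    using that by (simp add: w_def)
  have m: "1 \<in> w p \<longleftrightarrow> p \<in> U 1" "2 \<in> w p \<longleftrightarrow> p \<in> U 2" "3 \<in> w p \<longleftrightarrow> p \<in> U 3" "4 \<in> w p \<longleftrightarrow> p \<in> U 4" for p
    by (simp_all add: mem)
  have boxes: "is_box d (U 1)" "is_box d (U 2)" "is_box d (U 3)" "is_box d (U 4)"
    by (simp_all add: box)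
  define K where "K = U 2 \<inter> U 3 \<inter> U 4"
  \<comment> \<open>These equivalences are read off the five codewords: 1 occurs exactly with some
    of 2, 3, 4, and two of 2, 3, 4 force the third.\<close>
  have patterns: "(p \<in> U 1 \<longleftrightarrow> p \<in> U 2 \<or> p \<in> U 3 \<or> p \<in> U 4)
      \<and> (p \<in> U 2 \<and> p \<in> U 3 \<longleftrightarrow> p \<in> K) \<and> (p \<in> U 2 \<and> p \<in> U 4 \<longleftrightarrow> p \<in> K)
      \<and> (p \<in> U 3 \<and> p \<in> U 4 \<longleftrightarrow> p \<in> K)" for p
  proof (cases "p \<in> real_space d")
    case True
    then have "w p \<in> ?D" unfolding img[symmetric] by (rule imageI)
    then have "w p = {1, 2, 3, 4} \<or> w p = {1, 2} \<or> w p = {1, 3} \<or> w p = {1, 4} \<or> w p = {}"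
      by simp
    then show ?thesis
      unfolding K_def Int_iff m[symmetric] by (elim disjE) simp_all
  next
    \<comment> \<open>The code says nothing about functions outside \<open>real_space d\<close>, but
      no box contains them, so all sides are false.\<close>
    case False
    then show ?thesis
      unfolding K_def using boxes[THEN is_box_subset_real_space] by blast
  qed
  have U1: "U 1 = (\<Union>i\<in>{2, 3, 4}. U i)"
    using patterns by auto
  interpret box_star d "{2, 3, 4}" U K
  proof
    show "is_box d (U i)" if "i \<in> {2, 3, 4}" for i using that boxes by auto
    show "is_box d (\<Union>i\<in>{2, 3, 4}. U i)" using boxes(1) U1 by simp
    show "U i \<inter> U k = K" if "i \<in> {2, 3, 4}" "k \<in> {2, 3, 4}" "i \<noteq> k" for i k
      using that patterns by auto
  qed simp
  have surj: "\<exists>p. w p = \<sigma>" if "\<sigma> \<in> ?D" for \<sigma>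
    using that unfolding img[symmetric] by auto
  \<comment> \<open>The codeword 1234 makes the core nonempty; 12, 13 and 14 give each petal a point
    outside it.\<close>
  obtain p p2 p3 p4 where "w p = {1, 2, 3, 4}" "w p2 = {1, 2}" "w p3 = {1, 3}" "w p4 = {1, 4}"
    using surj[of "{1, 2, 3, 4}"] surj[of "{1, 2}"] surj[of "{1, 3}"] surj[of "{1, 4}"] by auto
  then have "p \<in> K" "p2 \<in> U 2 - K" "p3 \<in> U 3 - K" "p4 \<in> U 4 - K"
    using m[of p] m[of p2] m[of p3] m[of p4] by (auto simp: K_def)
  then show False using no_three_petals[of 2 3 4] by auto
qed

section \<open>A realization of the two-petal code on the line\<close>

text \<open>The intervals are [0,2], [0,1], [1,2] and the point 1. Without the codeword 14 the
  fourth set can shrink to the core, and the two remaining petals take the two sides of the point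
  1.\<close>

lemma interval_realization:
  fixes a b :: "nat \<Rightarrow> real"
  defines "a \<equiv> \<lambda>i. if i = 3 \<or> i = 4 then 1 else 0"
    and "b \<equiv> \<lambda>i. if i = 2 \<or> i = 4 then 1 else 2"
  shows "code_of 1 4 (\<lambda>i. {1..1} \<rightarrow>\<^sub>E {a i..b i}) = {{1, 2, 3, 4}, {1, 2}, {1, 3}, {}}"
    (is "?L = ?C")
proof -
  define w where "w t = {i \<in> {1..4}. a i \<le> t \<and> t \<le> b i}" for t
  have "{i \<in> {1..4}. p \<in> {1..1} \<rightarrow>\<^sub>E {a i..b i}} = w (p 1)" if "p \<in> real_space 1" for p
    using that by (auto simp: w_def real_space_def PiE_iff)
  then have "?L = w ` (\<lambda>p. p 1) ` real_space 1"
    unfolding code_of_eq_image image_image by (intro image_cong) auto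
  \<comment> \<open>Evaluation at 1 maps \<open>real_space 1\<close> onto the real line, so the code
    is the range of \<open>w\<close> over all reals.\<close>
  also have "(\<lambda>p. p 1) ` real_space 1 = UNIV"
  proof -
    have "(\<lambda>i\<in>{1..1}. t) \<in> real_space 1" "(\<lambda>i\<in>{1..1::nat}. t) 1 = t" for t :: real
      by (auto simp: real_space_def)
    then show ?thesis by (metis UNIV_eq_I image_eqI)
  qed
  also have "range w = ?C"
  proof
    have ab: "a 1 = 0" "a 2 = 0" "a 3 = 1" "a 4 = 1" "b 1 = 2" "b 2 = 1" "b 3 = 2" "b 4 = 1"
      by (simp_all add: a_def b_def)
    have mem: "i \<in> w t \<longleftrightarrow> i = 1 \<and> 0 \<le> t \<and> t \<le> 2 \<or> i = 2 \<and> 0 \<le> t \<and> t \<le> 1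
        \<or> i = 3 \<and> 1 \<le> t \<and> t \<le> 2 \<or> i = 4 \<and> t = 1" for i t
      unfolding w_def atLeastAtMost_1_4 using ab by (auto simp del: One_nat_def)
    have "w t \<in> ?C" for t
    proof (cases rule: linorder_cases[of t 1])
      case less
      then have "w t = (if 0 \<le> t then {1, 2} else {})" by (auto simp: mem)
      then show ?thesis by simp
    next
      case equal
      then have "w t = {1, 2, 3, 4}" by (auto simp: mem)
      then show ?thesis by simp
    next
      case greater
      then have "w t = (if t \<le> 2 then {1, 3} else {})" by (auto simp: mem)
      then show ?thesis by simp
    qed
    then show "range w \<subseteq> ?C" by blast
    \<comment> \<open>The sample points are the common point, the two ends of [0,2], and a point
      outside all intervals.\<close>
    have "w 1 = {1, 2, 3, 4}" "w 0 = {1, 2}" "w 2 = {1, 3}" "w 3 = {}"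
      by (auto simp: mem)
    then show "?C \<subseteq> range w" by (metis (no_types) empty_subsetI insert_subset rangeI)
  qed
  finally show ?thesis .
qed

theorem mainTheorem5:
  fixes C D :: "nat set set"
  assumes "C = {{1, 2, 3, 4}, {1, 2}, {1, 3}, {}}"
    and "D = {{1, 2, 3, 4}, {1, 2}, {1, 3}, {1, 4}, {}}"
  shows "C \<subseteq> Pow {1..4} \<and> D \<subseteq> Pow {1..4}
    \<and> C \<subseteq> D \<and> D \<subseteq> simplicial_complex_of 4 C
    \<and> box_convex 4 C
    \<and> (\<exists>a b :: nat \<Rightarrow> real. (\<forall>i \<in> {1..4}. a i \<le> b i)
          \<and> code_of 1 4 (\<lambda>i. {1..1} \<rightarrow>\<^sub>E {a i..b i}) = C)
    \<and> \<not> box_convex 4 D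
    \<and> \<not> (\<forall>n C' D'. C' \<subseteq> Pow {1..n} \<longrightarrow> C' \<subseteq> D' \<longrightarrow> D' \<subseteq> simplicial_complex_of n C' \<longrightarrow>
            box_convex n C' \<longrightarrow> box_convex n D')"
proof -
  have D: "D \<subseteq> Pow {1..4}" and CD: "C \<subseteq> D"
    by (simp_all add: assms)
  then have C: "C \<subseteq> Pow {1..4}" by (rule order_trans[rotated])
  \<comment> \<open>The full vertex set is a codeword, so the complex of \<open>C\<close> contains
    every subset of \<open>{1..4}\<close>.\<close>
  have "{1..4} \<in> C" unfolding assms atLeastAtMost_1_4 by (rule insertI1)
  then have D_cpx: "D \<subseteq> simplicial_complex_of 4 C"
    using D unfolding simplicial_complex_of_def by blast
  obtain a b :: "nat \<Rightarrow> real" where ab: "\<forall>i \<in> {1..4}. a i \<le> b i"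
    and code: "code_of 1 4 (\<lambda>i. {1..1} \<rightarrow>\<^sub>E {a i..b i}) = C"
  proof
    show "code_of 1 4 (\<lambda>i. {1..1} \<rightarrow>\<^sub>E {if i = 3 \<or> i = 4 then 1 else 0..
        if i = 2 \<or> i = 4 then 1 else 2}) = C"
      unfolding assms by (rule interval_realization)
  qed simp
  have "is_box 1 ({1..1} \<rightarrow>\<^sub>E {a i..b i})" if "i \<in> {1..4}" for i
    unfolding is_box_def using ab that
    by (intro disjI2 exI[of _ "\<lambda>_. a i"] exI[of _ "\<lambda>_. b i"]) simp
  then have C_box: "box_convex 4 C"
    unfolding box_convex_def using code
    by (intro exI[of _ 1] exI[of _ "\<lambda>i. {1..1} \<rightarrow>\<^sub>E {a i..b i}"]) simp
  have D_nbox: "\<not> box_convex 4 D"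
    unfolding assms by (rule not_box_convex_three_petals)
  show ?thesis
  proof (intro conjI)
    show "\<not> (\<forall>n C' D'. C' \<subseteq> Pow {1..n} \<longrightarrow> C' \<subseteq> D' \<longrightarrow> D' \<subseteq> simplicial_complex_of n C' \<longrightarrow>
            box_convex n C' \<longrightarrow> box_convex n D')"
      using C CD D_cpx C_box D_nbox by metis
  qed (fact | use ab code in blast)+
qed

end
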